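(* Let $s\in\mathbb{N}$, $m_1,m_2\in\mathbb{Z}$ and $t_1,t_2\in\mathbb{N}'$. The sequence $n\mapsto F_{t_1sn+m_1}F_{t_2sn+m_2}$ has $Z$ transform $$\mathcal{Z}\left(F_{t_1sn+m_1}F_{t_2sn+m_2}\right)=z\,\frac{\displaystyle\sum_{i=0}^{t_1+t_2}\sum_{j=0}^{i}(-1)^{\frac{(sj+2(s+1))(j+1)}{2}}\binom{t_1+t_2+1}{j}_{F_s}F_{m_1+t_1s(i-j)}F_{m_2+t_2s(i-j)}\,y^{\frac{sj(j-1)}{2}}z^{t_1+t_2-i}}{\displaystyle\sum_{i=0}^{t_1+t_2+1}(-1)^{\frac{(si+2(s+1))(i+1)}{2}}\binom{t_1+t_2+1}{i}_{F_s}y^{\frac{si(i-1)}{2}}z^{t_1+t_2+1-i}}.$$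
   Context: $\mathbb{N}=\{1,2,\dots\}$, $\mathbb{N}'=\mathbb{N}\cup\{0\}$. $x,y$ are indeterminates and we abbreviate $F_n=F_n(x,y)$. The bivariate Fibonacci polynomials are $F_0=0$, $F_1=1$, $F_{n+2}=xF_{n+1}+yF_n$, extended to negative indices by $F_{-n}=-(-y)^{-n}F_n$ ($n\in\mathbb{N}$). For $n,k\in\mathbb{N}'$ the bivariate $s$-Fibopolynomial is $\binom{n}{k}_{F_s}=\frac{F_{sn}F_{s(n-1)}\cdots F_{s(n-k+1)}}{F_sF_{2s}\cdots F_{ks}}$ (equal to $1$ for $k=0$ and $k=n$, and to $0$ if $k>n$). The $Z$ transform of a sequence $(a_n)_{n\ge0}$ is $\mathcal{Z}(a_n)=\sum_{n\ge0}a_nz^{-n}$, regarded as a formal power series in $z^{-1}$ with coefficients in $\mathbb{C}(x,y)$ (equivalently, for fixed complex $x,y$ with $y\neq0$, as a function of $z$ for $|z|$ large). *)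

theory Defs
  imports Complex_Main "HOL-Computational_Algebra.Computational_Algebra"
begin

(* The field \<complex>(x,y); the outer polynomial variable is x, the inner one is y. *)
type_synonym cxy = "complex poly poly fract"

definition var_x :: cxy where
  "var_x = to_fract [:0, 1:]"

definition var_y :: cxy where
  "var_y = to_fract [:[:0, 1:]:]"

fun fib_nat :: "'a::field \<Rightarrow> 'a \<Rightarrow> nat \<Rightarrow> 'a" where
  "fib_nat x y 0 = 0"
| "fib_nat x y (Suc 0) = 1"
| "fib_nat x y (Suc (Suc n)) = x * fib_nat x y (Suc n) + y * fib_nat x y n"

definition bfib :: "'a::field \<Rightarrow> 'a \<Rightarrow> int \<Rightarrow> 'a" where
  "bfib x y m =
     (if m \<ge> 0 then fib_nat x y (nat m)
      else - ((- y) powi m) * fib_nat x y (nat (- m)))"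

(* For k > n the numerator contains the factor at index 0, so the value is 0. *)
definition fibopoly :: "'a::field \<Rightarrow> 'a \<Rightarrow> nat \<Rightarrow> nat \<Rightarrow> nat \<Rightarrow> 'a" where
  "fibopoly x y s n k =
     (\<Prod>i<k. bfib x y (int s * (int n - int i))) / (\<Prod>i=1..k. bfib x y (int (i * s)))"

(* Formal Laurent series in the variable 1/z: the library's fls_X plays the role of 1/z,
   hence z itself is fls_X_inv. *)
definition zvar :: "'a::field fls" where
  "zvar = fls_X_inv"

definition z_transform :: "(nat \<Rightarrow> 'a::field) \<Rightarrow> 'a fls" where
  "z_transform a = fps_to_fls (Abs_fps a)"

abbreviation F :: "int \<Rightarrow> cxy" where
  "F \<equiv> bfib var_x var_y"

abbreviation Fbinom :: "nat \<Rightarrow> nat \<Rightarrow> nat \<Rightarrow> cxy" where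
  "Fbinom \<equiv> fibopoly var_x var_y"

end

theory Submission
  imports Defs "HOL-Number_Theory.Fib" "HOL-Algebra.Algebraic_Closure_Type"
begin

text \<open>
  Over the algebraic closure of \<open>\<complex>(x,y)\<close> let \<open>\<alpha>, \<beta>\<close> be the roots of \<open>T\<^sup>2 = x T + y\<close>, and put
  \<open>A = \<alpha>\<^sup>s\<close>, \<open>B = \<beta>\<^sup>s\<close>. By the homogeneous \<open>q\<close>-binomial theorem the denominator is, up to the sign
  \<open>(-1)\<^bsup>s+1\<^esup>\<close>, the product of the \<open>z - A\<^sup>k B\<^bsup>t1+t2-k\<^esup>\<close> for \<open>0 \<le> k \<le> t1 + t2\<close>. By Binet's formula
  the sequence is a linear combination of the \<open>n\<close>-th powers of four of these roots, so it satisfies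
  the recurrence given by the denominator; the numerator collects the initial terms.
\<close>

section \<open>Formal series in 1/z and linear recurrences\<close>

lemma sum_zvar_powers:
  includes fps_syntax
  fixes f :: "nat \<Rightarrow> 'a::field"
  shows "(\<Sum>i=0..d. fls_const (f i) * zvar ^ (d - i)) =
    zvar ^ d * z_transform (\<lambda>i. if i \<le> d then f i else 0)"
proof (rule fls_eqI)
  fix k :: int
  have "(\<Sum>i=0..d. fls_const (f i) * zvar ^ (d - i)) $$ k =
      (\<Sum>i=0..d. if k = - int (d - i) then f i else 0)"
    by (auto simp: fls_nth_sum zvar_def intro!: sum.cong)
  \<comment> \<open>Since \<open>nat\<close> sends negative integers to 0, the guard
    \<open>- int d \<le> k\<close> is what keeps i = 0 from being picked when k < -d.\<close>
  also have "\<dots> = (\<Sum>i=0..d. if i = nat (k + int d) \<and> - int d \<le> k then f i else 0)"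
    by (intro sum.cong) auto
  also have "\<dots> = (if - int d \<le> k \<and> nat (k + int d) \<le> d then f (nat (k + int d)) else 0)"
    by (cases "- int d \<le> k") (auto simp: sum.delta)
  also have "\<dots> = (zvar ^ d * z_transform (\<lambda>i. if i \<le> d then f i else 0)) $$ k"
    by (auto simp: zvar_def z_transform_def fls_X_inv_power_conv_shift_1 fls_shifted_times_simps)
  finally show "(\<Sum>i=0..d. fls_const (f i) * zvar ^ (d - i)) $$ k =
      (zvar ^ d * z_transform (\<lambda>i. if i \<le> d then f i else 0)) $$ k" .
qed

lemma fls_const_sum: "fls_const (\<Sum>i\<in>I. f i) = (\<Sum>i\<in>I. fls_const (f i))"
  by (rule fls_eqI) (simp add: fls_nth_sum sum.delta)

text \<open>In the product of the generating functions of c (cut off after \<open>Suc N\<close>) and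
  a, the recurrence kills every coefficient beyond N, so the product is a polynomial in 1/z.\<close>

lemma z_transform_linear_recurrence:
  includes fps_syntax
  fixes a c :: "nat \<Rightarrow> 'a::field"
  assumes "c 0 \<noteq> 0"
    and rec: "\<And>n. n > N \<Longrightarrow> (\<Sum>j\<le>Suc N. c j * a (n - j)) = 0"
  shows "z_transform a =
    zvar * ((\<Sum>i=0..N. fls_const (\<Sum>j=0..i. c j * a (i - j)) * zvar ^ (N - i)) /
            (\<Sum>i=0..Suc N. fls_const (c i) * zvar ^ (Suc N - i)))"
proof -
  let ?C = "\<lambda>i. if i \<le> Suc N then c i else 0"
  let ?M = "\<lambda>i. if i \<le> N then \<Sum>j=0..i. c j * a (i - j) else 0"
  have "Abs_fps ?C * Abs_fps a = Abs_fps ?M"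
  proof (rule fps_ext)
    fix n
    show "(Abs_fps ?C * Abs_fps a) $ n = Abs_fps ?M $ n"
    proof (cases "n \<le> N")
      case True
      then show ?thesis by (auto simp: fps_mult_nth intro!: sum.cong)
    next
      case False
      have "(Abs_fps ?C * Abs_fps a) $ n = (\<Sum>j\<le>Suc N. c j * a (n - j))"
        unfolding fps_mult_nth using False by (intro sum.mono_neutral_cong_right) auto
      then show ?thesis using rec[of n] False by simp
    qed
  qed
  then have "z_transform ?C * z_transform a = z_transform ?M"
    by (simp add: z_transform_def flip: fls_times_fps_to_fls)
  moreover have "z_transform ?C \<noteq> 0"
    using assms(1) by (auto simp: z_transform_def fps_eq_iff)
  ultimately have "z_transform a = z_transform ?M / z_transform ?C"
    by (simp add: field_simps)
  moreover have "zvar \<noteq> (0 :: 'a fls)"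
    by (simp add: zvar_def)
  \<comment> \<open>Reversing exponents costs z^N above and z^(N+1) below; the leading
    \<open>zvar\<close> makes up the difference.\<close>
  ultimately show ?thesis
    unfolding sum_zvar_powers by (simp add: field_simps)
qed

section \<open>Passage to the algebraic closure and nonvanishing facts\<close>

lemma to_ac_fib_nat: "to_ac (fib_nat x y n) = fib_nat (to_ac x) (to_ac y) n"
  by (induction x y n rule: fib_nat.induct) simp_all

lemma to_ac_bfib: "to_ac (bfib x y m) = bfib (to_ac x) (to_ac y) m"
  by (simp add: bfib_def to_ac_fib_nat power_int_def)

lemma to_ac_fibopoly: "to_ac (fibopoly x y s n k) = fibopoly (to_ac x) (to_ac y) s n k"
  by (simp add: fibopoly_def to_ac_prod to_ac_bfib)

lemma fib_nat_neq_0: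
  assumes "n > 0"
  shows "fib_nat var_x var_y n \<noteq> 0"
proof -
  \<comment> \<open>F_n is a polynomial, and specializing x = y = 1 gives the ordinary Fibonacci
    number, which is nonzero for n > 0.\<close>
  have "\<exists>p. fib_nat var_x var_y n = to_fract p \<and> poly (poly p 1) 1 = of_nat (fib n)" for n
  proof (induction n rule: induct_nat_012)
    case 0
    show ?case by (intro exI[of _ 0]) simp
  next
    case 1
    show ?case by (intro exI[of _ 1]) simp
  next
    case (ge2 k)
    then obtain p q where
      "fib_nat var_x var_y k = to_fract p" "poly (poly p 1) 1 = of_nat (fib k)"
      "fib_nat var_x var_y (Suc k) = to_fract q" "poly (poly q 1) 1 = of_nat (fib (Suc k))"
      by blast
    then show ?case
      by (intro exI[of _ "[:0, 1:] * q + [:[:0, 1:]:] * p"])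
         (simp only: fib_nat.simps var_x_def var_y_def to_fract_add to_fract_mult, simp)
  qed
  then obtain p
    where "fib_nat var_x var_y n = to_fract p" "poly (poly p 1) 1 = of_nat (fib n)"
    by blast
  moreover have "fib n \<noteq> 0"
    using fib_neq_0_nat[OF assms] by simp
  ultimately show ?thesis by auto
qed

lemma var_y_neq_0: "var_y \<noteq> 0"
  by (simp add: var_y_def)

text \<open>The discriminant will equal (\<alpha> - \<beta>)^2, so this separates the two
  roots.\<close>

lemma discriminant_neq_0: "var_x ^ 2 + 4 * var_y \<noteq> 0"
proof -
  have "4 * var_y = (var_y + var_y) + (var_y + var_y)"
    by simp
  then have "var_x ^ 2 + 4 * var_y = to_fract ([:0, 1:] ^ 2 + [:[:0, 4:]:])"
    unfolding var_x_def var_y_def power2_eq_square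
    by (simp only: flip: to_fract_add to_fract_mult) simp
  also have "\<dots> \<noteq> 0"
    by (simp add: power2_eq_square)
  finally show ?thesis .
qed

section \<open>Binet's formula and a Pascal rule, in any field containing both roots\<close>

locale binet =
  fixes x y \<alpha> \<beta> :: "'a::field" and s :: nat
  assumes x_eq: "x = \<alpha> + \<beta>" and y_eq: "y = - (\<alpha> * \<beta>)"
    and roots_nonzero: "\<alpha> \<noteq> 0" "\<beta> \<noteq> 0" and roots_distinct: "\<alpha> \<noteq> \<beta>"
    and fib_nonzero: "\<And>n. n > 0 \<Longrightarrow> fib_nat x y n \<noteq> 0"
    and s_pos: "s > 0"
begin

definition "A = \<alpha> ^ s"
definition "B = \<beta> ^ s"

lemma binet_nat: "(\<alpha> - \<beta>) * fib_nat x y n = \<alpha> ^ n - \<beta> ^ n"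
proof (induction n rule: induct_nat_012)
  case (ge2 n)
  have "(\<alpha> - \<beta>) * fib_nat x y (Suc (Suc n)) =
      x * ((\<alpha> - \<beta>) * fib_nat x y (Suc n)) + y * ((\<alpha> - \<beta>) * fib_nat x y n)"
    by (simp add: algebra_simps)
  also have "\<dots> = \<alpha> ^ Suc (Suc n) - \<beta> ^ Suc (Suc n)"
    unfolding ge2.IH by (simp add: x_eq y_eq algebra_simps)
  finally show ?case .
qed simp_all

lemma binet_int: "(\<alpha> - \<beta>) * bfib x y m = \<alpha> powi m - \<beta> powi m"
proof (cases "m \<ge> 0")
  case True
  then show ?thesis by (simp add: bfib_def binet_nat power_int_def)
next
  case False
  \<comment> \<open>As -y = \<alpha>\<beta>, the factor (-y)^m turns \<alpha>^(-m) into \<beta>^m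
    and \<beta>^(-m) into \<alpha>^m; the outer minus sign restores the order.\<close>
  have "(\<alpha> - \<beta>) * bfib x y m = - ((\<alpha> * \<beta>) powi m) * ((\<alpha> - \<beta>) * fib_nat x y (nat (- m)))"
    using False by (simp add: bfib_def y_eq)
  also have "\<dots> = - ((\<alpha> * \<beta>) powi m) * (\<alpha> powi (- m) - \<beta> powi (- m))"
    using False unfolding binet_nat by (simp add: power_int_def)
  also have "\<dots> = \<alpha> powi m - \<beta> powi m"
    using roots_nonzero by (simp add: power_int_mult_distrib power_int_minus field_simps)
  finally show ?thesis .
qed

lemma binet_AB: "(\<alpha> - \<beta>) * bfib x y (int (n * s)) = A ^ n - B ^ n"
  by (simp add: binet_int A_def B_def power_int_of_nat mult.commute[of n] power_mult
      del: of_nat_mult)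

lemma bfib_neq_0: "n > 0 \<Longrightarrow> bfib x y (int (n * s)) \<noteq> 0"
  using fib_nonzero[of "n * s"] s_pos by (simp add: bfib_def nat_mult_distrib del: of_nat_mult)

lemma fibopoly_0: "fibopoly x y s n 0 = 1"
  by (simp add: fibopoly_def)

lemma fibopoly_self_Suc: "fibopoly x y s n (Suc n) = 0"
  by (simp add: fibopoly_def bfib_def)

text \<open>After cancelling common factors this is F_{(n+1)s} = B^(k+1) F_{(n-k)s} + A^(n-k)
  F_{(k+1)s}, where Binet makes the mixed terms A^(n-k) B^(k+1) cancel.\<close>

lemma fibopoly_Suc_Suc:
  assumes "k \<le> n"
  shows "fibopoly x y s (Suc n) (Suc k) =
    B ^ Suc k * fibopoly x y s n (Suc k) + A ^ (n - k) * fibopoly x y s n k"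
proof -
  let ?g = "\<lambda>m. bfib x y (int (m * s))"
  define P where "P = (\<Prod>i<k. bfib x y (int s * (int n - int i)))"
  define D where "D = (\<Prod>i=1..k. ?g i)"
  have D: "D \<noteq> 0"
    unfolding D_def using bfib_neq_0 by (auto simp del: of_nat_mult)
  have "(\<alpha> - \<beta>) * ?g (Suc n) = (\<alpha> - \<beta>) * (B ^ Suc k * ?g (n - k) + A ^ (n - k) * ?g (Suc k))"
  proof -
    have "(\<alpha> - \<beta>) * (B ^ Suc k * ?g (n - k) + A ^ (n - k) * ?g (Suc k)) =
        B ^ Suc k * ((\<alpha> - \<beta>) * ?g (n - k)) + A ^ (n - k) * ((\<alpha> - \<beta>) * ?g (Suc k))"
      by (simp add: algebra_simps del: of_nat_mult)
    also have "\<dots> = A ^ ((n - k) + Suc k) - B ^ (Suc k + (n - k))"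
      unfolding binet_AB power_add by (simp add: algebra_simps)
    also have "\<dots> = (\<alpha> - \<beta>) * ?g (Suc n)"
      unfolding binet_AB using assms by simp
    finally show ?thesis ..
  qed
  then have g: "?g (Suc n) = B ^ Suc k * ?g (n - k) + A ^ (n - k) * ?g (Suc k)"
    using roots_distinct by simp
  have "(\<Prod>i<Suc k. bfib x y (int s * (int (Suc n) - int i))) = ?g (Suc n) * P"
    unfolding P_def prod.lessThan_Suc_shift by (simp add: algebra_simps)
  then have f1: "fibopoly x y s (Suc n) (Suc k) = ?g (Suc n) * P / (D * ?g (Suc k))"
    by (simp add: fibopoly_def D_def del: of_nat_mult of_nat_Suc prod.lessThan_Suc)
  have "(\<Prod>i<Suc k. bfib x y (int s * (int n - int i))) = P * ?g (n - k)"
    using assms by (simp add: P_def of_nat_diff mult.commute)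
  then have f2: "fibopoly x y s n (Suc k) = P * ?g (n - k) / (D * ?g (Suc k))"
    by (simp add: fibopoly_def D_def del: of_nat_mult of_nat_Suc prod.lessThan_Suc)
  have f3: "fibopoly x y s n k = P / D"
    by (simp add: fibopoly_def D_def P_def)
  show ?thesis
    using D bfib_neq_0[of "Suc k"] unfolding f1 f2 f3 g
    by (simp add: divide_simps del: of_nat_mult of_nat_Suc power_Suc) (simp add: algebra_simps)
qed

section \<open>The homogeneous q-binomial theorem and the roots of the denominator\<close>

definition coef :: "nat \<Rightarrow> nat \<Rightarrow> 'a" where
  "coef n i = (-1) ^ i * fibopoly x y s n i * (A * B) ^ (i choose 2)"

lemma coef_0: "coef n 0 = 1"
  by (simp add: coef_def fibopoly_0 choose_two)

lemma coef_Suc_self: "coef n (Suc n) = 0"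
  by (simp add: coef_def fibopoly_self_Suc)

lemma coef_Suc_Suc:
  assumes "k \<le> n"
  shows "coef (Suc n) (Suc k) = B ^ Suc k * coef n (Suc k) - A ^ n * B ^ k * coef n k"
proof -
  \<comment> \<open>Raising k to k + 1 raises the exponent \<open>k choose 2\<close> by k; of the
    extra (AB)^k, the part A^k completes A^(n-k) to A^n.\<close>
  have "A ^ n = A ^ (n - k) * A ^ k"
    using assms by (simp flip: power_add)
  then show ?thesis
    unfolding coef_def fibopoly_Suc_Suc[OF assms]
    by (simp add: numeral_2_eq_2 power_add power_mult_distrib algebra_simps)
qed

text \<open>Homogenizing with \<open>u\<close> lets the induction replace \<open>u\<close> by \<open>B u\<close> instead of dividing \<open>w\<close> by \<open>B\<close>.\<close>
lemma q_binomial: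
  "(\<Sum>i\<le>n. coef n i * u ^ i * w ^ (n - i)) = (\<Prod>k<n. w - A ^ k * B ^ (n - 1 - k) * u)"
proof (induction n arbitrary: u)
  case 0
  show ?case by (simp add: coef_0)
next
  case (Suc n)
  let ?S = "\<Sum>i\<le>n. coef n i * (B * u) ^ i * w ^ (n - i)"
  have "(\<Sum>i\<le>Suc n. coef (Suc n) i * u ^ i * w ^ (Suc n - i)) =
      w ^ Suc n + (\<Sum>k\<le>n. coef (Suc n) (Suc k) * u ^ Suc k * w ^ (n - k))"
    unfolding sum.atMost_Suc_shift by (simp add: coef_0)
  \<comment> \<open>In the Pascal rule B^(k+1) and B^k are absorbed into powers of Bu, so both sums
    involve the same argument.\<close>
  also have "(\<Sum>k\<le>n. coef (Suc n) (Suc k) * u ^ Suc k * w ^ (n - k)) =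
      (\<Sum>k\<le>n. coef n (Suc k) * (B * u) ^ Suc k * w ^ (n - k)) - A ^ n * u * ?S"
    unfolding sum_distrib_left sum_subtractf[symmetric]
    by (intro sum.cong) (auto simp: coef_Suc_Suc power_mult_distrib algebra_simps)
  also have "w ^ Suc n + (\<dots>) =
      (\<Sum>i\<le>Suc n. coef n i * (B * u) ^ i * w ^ (Suc n - i)) - A ^ n * u * ?S"
    unfolding sum.atMost_Suc_shift by (simp add: coef_0)
  \<comment> \<open>The top term vanishes by \<open>coef_Suc_self\<close>; every other term contains
    a factor w.\<close>
  also have "(\<Sum>i\<le>Suc n. coef n i * (B * u) ^ i * w ^ (Suc n - i)) = w * ?S"
    by (simp add: coef_Suc_self sum_distrib_left Suc_diff_le mult_ac)
  also have "w * ?S - A ^ n * u * ?S = (w - A ^ n * u) * ?S"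
    by (simp add: algebra_simps)
  \<comment> \<open>The hypothesis at Bu raises each exponent of B by one; the extracted w - A^n u
    is the new factor k = n.\<close>
  also have "?S = (\<Prod>k<n. w - A ^ k * B ^ (Suc n - 1 - k) * u)"
    unfolding Suc.IH
  proof (intro prod.cong refl)
    fix k assume "k \<in> {..<n}"
    then have "Suc n - 1 - k = Suc (n - 1 - k)" by auto
    then show "w - A ^ k * B ^ (n - 1 - k) * (B * u) = w - A ^ k * B ^ (Suc n - 1 - k) * u"
      by (simp only: power_Suc mult_ac)
  qed
  finally show ?case by (simp add: mult.commute)
qed

text \<open>With u = 1 and w = A^p B^q, the factor k = p of the product in \<open>q_binomial\<close>
  is zero.\<close>

lemma coef_root_powers:
  assumes "p + q = N" "N < n"
  shows "(\<Sum>j\<le>Suc N. coef (Suc N) j * (A ^ p * B ^ q) ^ (n - j)) = 0"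
proof -
  let ?r = "A ^ p * B ^ q"
  \<comment> \<open>Because N < n, all subtractions are exact and a common power of the root splits
    off.\<close>
  have "(\<Sum>j\<le>Suc N. coef (Suc N) j * ?r ^ (n - j)) =
      (\<Sum>j\<le>Suc N. coef (Suc N) j * 1 ^ j * ?r ^ (Suc N - j)) * ?r ^ (n - Suc N)"
    unfolding sum_distrib_right using assms(2)
    by (intro sum.cong) (auto simp: mult.assoc simp flip: power_add)
  also have "(\<Sum>j\<le>Suc N. coef (Suc N) j * 1 ^ j * ?r ^ (Suc N - j)) = 0"
    unfolding q_binomial using assms(1)
    by (intro prod_zero finite_lessThan bexI[of _ p]) auto
  finally show ?thesis by simp
qed

section \<open>The recurrence for the product sequence\<close>

lemma powi_linear:
  fixes r :: 'a
  assumes "r \<noteq> 0"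
  shows "r powi (int (t * s * n) + m) = ((r ^ s) ^ t) ^ n * r powi m"
proof -
  have "r ^ (t * s * n) = ((r ^ s) ^ t) ^ n"
    by (simp only: power_mult[symmetric] mult_ac)
  then show ?thesis
    using assms by (simp add: power_int_add power_int_of_nat del: of_nat_mult)
qed

text \<open>Multiplying by (\<alpha> - \<beta>)^2 clears the Binet denominators. The product then
  expands into four geometric sequences with ratios A^p B^q, p + q = t1 + t2, each killed by
  \<open>coef_root_powers\<close>.\<close>

lemma coef_recurrence:
  assumes "t1 + t2 < n"
  shows "(\<Sum>j\<le>Suc (t1 + t2). coef (Suc (t1 + t2)) j *
      (bfib x y (int (t1 * s * (n - j)) + m1) * bfib x y (int (t2 * s * (n - j)) + m2))) = 0"
    (is "?L = 0")
proof -
  let ?c = "coef (Suc (t1 + t2))"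
  define e1 e2 f1 f2 where ef: "e1 = \<alpha> powi m1" "e2 = \<alpha> powi m2" "f1 = \<beta> powi m1" "f2 = \<beta> powi m2"
  let ?S = "\<lambda>p q. \<Sum>j\<le>Suc (t1 + t2). ?c j * (A ^ p * B ^ q) ^ (n - j)"
  have lin: "(\<alpha> - \<beta>) * bfib x y (int (t * s * k) + m) =
      (A ^ t) ^ k * \<alpha> powi m - (B ^ t) ^ k * \<beta> powi m" for t k m
    unfolding binet_int A_def B_def by (simp only: powi_linear[OF roots_nonzero(1)] powi_linear[OF roots_nonzero(2)])
  have prod: "(\<alpha> - \<beta>) ^ 2 * (bfib x y (int (t1 * s * k) + m1) * bfib x y (int (t2 * s * k) + m2)) =
      e1 * e2 * (A ^ (t1 + t2) * B ^ 0) ^ k - e1 * f2 * (A ^ t1 * B ^ t2) ^ k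
      - f1 * e2 * (A ^ t2 * B ^ t1) ^ k + f1 * f2 * (A ^ 0 * B ^ (t1 + t2)) ^ k" for k
  proof -
    have "(\<alpha> - \<beta>) ^ 2 * (bfib x y (int (t1 * s * k) + m1) * bfib x y (int (t2 * s * k) + m2)) =
        ((\<alpha> - \<beta>) * bfib x y (int (t1 * s * k) + m1)) * ((\<alpha> - \<beta>) * bfib x y (int (t2 * s * k) + m2))"
      by (simp add: power2_eq_square del: of_nat_mult)
    then show ?thesis
      unfolding lin ef[symmetric] by (simp add: power_add power_mult_distrib algebra_simps)
  qed
  have "(\<alpha> - \<beta>) ^ 2 * ?L = (\<Sum>j\<le>Suc (t1 + t2). ?c j * ((\<alpha> - \<beta>) ^ 2 *
      (bfib x y (int (t1 * s * (n - j)) + m1) * bfib x y (int (t2 * s * (n - j)) + m2))))"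
    unfolding sum_distrib_left by (intro sum.cong) (simp_all only: mult.left_commute)
  also have "\<dots> = e1 * e2 * ?S (t1 + t2) 0 - e1 * f2 * ?S t1 t2 - f1 * e2 * ?S t2 t1
      + f1 * f2 * ?S 0 (t1 + t2)"
    unfolding prod sum_distrib_left sum_subtractf[symmetric] sum.distrib[symmetric]
    by (intro sum.cong refl) (simp only: algebra_simps)
  also have "\<dots> = 0"
    using assms by (simp only: coef_root_powers add.commute add_0_left add_0_right) simp
  finally show ?thesis using roots_distinct by simp
qed

text \<open>Since AB = (-y)^s, the power of AB in \<open>coef\<close> supplies both the power of y
  and the sign (-1)^(sk), k = \<open>i choose 2\<close>. Both halvings are exact, as i(i-1) and
  i(i+1) are even.\<close>

lemma coef_eq:
  "(-1) ^ ((s * i + 2 * (s + 1)) * (i + 1) div 2) * fibopoly x y s n i * y ^ (s * i * (i - 1) div 2)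
    = (-1) ^ (s + 1) * coef n i"
proof -
  define k where "k = i choose 2"
  have k: "i * (i - 1) = 2 * k"
    unfolding k_def choose_two by (cases i) simp_all
  have i: "i * (i + 1) = 2 * (k + i)"
    using k by (cases i) (auto simp: algebra_simps)
  have "(s * i + 2 * (s + 1)) * (i + 1) = s * (i * (i + 1)) + 2 * (s + 1) * (i + 1)"
    by (simp only: algebra_simps)
  then have "(s * i + 2 * (s + 1)) * (i + 1) div 2 = s * (k + i) + (s + 1) * (i + 1)"
    unfolding i by (simp only: mult.assoc mult.left_commute[of s 2] flip: distrib_left) simp
  \<comment> \<open>Isolating the even summand 2si leaves exactly the parity of sk + i +
    (s+1).\<close>
  also have "\<dots> = s * k + i + (s + 1) + 2 * (s * i)"
    by (simp add: algebra_simps)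
  finally have "(-1::'a) ^ ((s * i + 2 * (s + 1)) * (i + 1) div 2) =
      (-1) ^ (s * k) * (-1) ^ i * (-1) ^ (s + 1)"
    by (simp only: power_add power_mult[of _ 2]) simp
  moreover have "s * i * (i - 1) div 2 = s * k"
    unfolding mult.assoc k by simp
  moreover have "(A * B) ^ k = (-1) ^ (s * k) * y ^ (s * k)"
    by (simp add: A_def B_def y_eq flip: power_mult power_mult_distrib)
  ultimately show ?thesis
    unfolding coef_def k_def[symmetric] by (simp only: mult_ac)
qed

end

text \<open>The embedding \<open>to_ac\<close> is injective, so the identity can be checked in the
  closure, where \<alpha> and \<beta> exist.\<close>

lemma recurrence:
  fixes s t1 t2 n :: nat and m1 m2 :: int
  assumes "s \<ge> 1" "t1 + t2 < n"
  shows "(\<Sum>j\<le>Suc (t1 + t2).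
      ((-1) ^ ((s * j + 2 * (s + 1)) * (j + 1) div 2) * Fbinom s (Suc (t1 + t2)) j
        * var_y ^ (s * j * (j - 1) div 2)) *
      (F (int (t1 * s * (n - j)) + m1) * F (int (t2 * s * (n - j)) + m2))) = 0" (is "?L = 0")
proof -
  let ?x = "to_ac var_x" and ?y = "to_ac var_y"
  \<comment> \<open>\<alpha> is a root of T^2 - xT - y; the other root is then x - \<alpha>.\<close>
  obtain \<alpha> where "poly [:- ?y, - ?x, 1:] \<alpha> = 0"
    using alg_closed_imp_poly_has_root[of "[:- ?y, - ?x, 1:]"] by auto
  then have \<alpha>: "\<alpha> * (\<alpha> - ?x) = ?y"
    by (simp add: algebra_simps add_eq_0_iff)
  define \<beta> where "\<beta> = ?x - \<alpha>"
  interpret binet ?x ?y \<alpha> \<beta> s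
  proof
    show "?x = \<alpha> + \<beta>" by (simp add: \<beta>_def)
    show y: "?y = - (\<alpha> * \<beta>)" using \<alpha> by (simp add: \<beta>_def algebra_simps)
    have "?y \<noteq> 0" by (simp add: var_y_neq_0)
    with y show "\<alpha> \<noteq> 0" "\<beta> \<noteq> 0" by auto
    have "to_ac (var_x ^ 2 + 4 * var_y) = (\<alpha> - \<beta>) ^ 2"
      unfolding to_ac_add to_ac_mult to_ac_power to_ac_numeral y
      by (simp add: \<beta>_def power2_eq_square algebra_simps)
    moreover have "to_ac (var_x ^ 2 + 4 * var_y) \<noteq> 0"
      unfolding to_ac_eq_0_iff by (rule discriminant_neq_0)
    ultimately show "\<alpha> \<noteq> \<beta>" by auto
    show "fib_nat ?x ?y n \<noteq> 0" if "n > 0" for n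
      using fib_nat_neq_0[OF that] by (simp flip: to_ac_fib_nat)
    show "s > 0" using assms(1) by simp
  qed
  have "to_ac ?L = (\<Sum>j\<le>Suc (t1 + t2). ((-1) ^ (s + 1) * coef (Suc (t1 + t2)) j) *
      (bfib ?x ?y (int (t1 * s * (n - j)) + m1) * bfib ?x ?y (int (t2 * s * (n - j)) + m2)))"
    unfolding coef_eq[symmetric] to_ac_sum to_ac_mult to_ac_power to_ac_bfib to_ac_fibopoly
      to_ac_minus to_ac_1 ..
  also have "\<dots> = (-1) ^ (s + 1) * (\<Sum>j\<le>Suc (t1 + t2). coef (Suc (t1 + t2)) j *
      (bfib ?x ?y (int (t1 * s * (n - j)) + m1) * bfib ?x ?y (int (t2 * s * (n - j)) + m2)))"
    unfolding sum_distrib_left by (simp only: mult.assoc)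
  also have "\<dots> = 0"
    by (simp only: coef_recurrence[OF assms(2)] mult_zero_right)
  finally show ?thesis by (simp only: to_ac_eq_0_iff)
qed

theorem theorem7:
  fixes s t1 t2 :: nat and m1 m2 :: int
  assumes "s \<ge> 1"
  shows "z_transform (\<lambda>n. F (int (t1 * s * n) + m1) * F (int (t2 * s * n) + m2)) =
    zvar *
    ((\<Sum>i=0..t1 + t2. \<Sum>j=0..i.
        fls_const ((-1) ^ ((s * j + 2 * (s + 1)) * (j + 1) div 2)
          * Fbinom s (t1 + t2 + 1) j
          * F (m1 + int (t1 * s * (i - j))) * F (m2 + int (t2 * s * (i - j)))
          * var_y ^ (s * j * (j - 1) div 2))
        * zvar ^ (t1 + t2 - i))
     / (\<Sum>i=0..t1 + t2 + 1.
        fls_const ((-1) ^ ((s * i + 2 * (s + 1)) * (i + 1) div 2)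
          * Fbinom s (t1 + t2 + 1) i
          * var_y ^ (s * i * (i - 1) div 2))
        * zvar ^ (t1 + t2 + 1 - i)))"
proof -
  let ?c = "\<lambda>j. (-1) ^ ((s * j + 2 * (s + 1)) * (j + 1) div 2) * Fbinom s (Suc (t1 + t2)) j
    * var_y ^ (s * j * (j - 1) div 2)"
  let ?a = "\<lambda>n. F (int (t1 * s * n) + m1) * F (int (t2 * s * n) + m2)"
  \<comment> \<open>The leading coefficient is (-1)^(s+1).\<close>
  have "?c 0 \<noteq> 0"
    by (simp add: fibopoly_def)
  then have "z_transform ?a =
    zvar * ((\<Sum>i=0..t1 + t2. fls_const (\<Sum>j=0..i. ?c j * ?a (i - j)) * zvar ^ (t1 + t2 - i)) /
            (\<Sum>i=0..Suc (t1 + t2). fls_const (?c i) * zvar ^ (Suc (t1 + t2) - i)))"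
    using recurrence[OF assms] by (rule z_transform_linear_recurrence)
  also have "(\<Sum>i=0..t1 + t2. fls_const (\<Sum>j=0..i. ?c j * ?a (i - j)) * zvar ^ (t1 + t2 - i)) =
    (\<Sum>i=0..t1 + t2. \<Sum>j=0..i.
        fls_const ((-1) ^ ((s * j + 2 * (s + 1)) * (j + 1) div 2)
          * Fbinom s (t1 + t2 + 1) j
          * F (m1 + int (t1 * s * (i - j))) * F (m2 + int (t2 * s * (i - j)))
          * var_y ^ (s * j * (j - 1) div 2))
        * zvar ^ (t1 + t2 - i))"
    unfolding fls_const_sum sum_distrib_right Suc_eq_plus1
    by (simp only: ac_simps)
  finally show ?thesis
    unfolding Suc_eq_plus1 .
qed

end
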